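(* For each $i\ge 1$ let $B(2,i)$ be a binary de Bruijn sequence of order $i$, and let $\alpha\in[0,1)$ be the real number whose binary expansion is $$\alpha = 0\,.\,B(2,1)^{1^1}\, B(2,2)^{2^2}\, B(2,3)^{3^3}\cdots B(2,i)^{i^i}\cdots .$$ Then $\alpha$ is a Liouville number.
   Context: A binary de Bruijn sequence $B(2,i)$ of order $i$ is a finite string over $\{0,1\}$ of length $2^i$ in which, read cyclically (i.e. also counting occurrences that wrap around from the end of the string to its beginning), every string in $\{0,1\}^i$ occurs exactly once. For a string $w$ and a positive integer $t$, $w^t$ denotes the concatenation of $t$ copies of $w$; juxtaposition of strings denotes concatenation. A real number $\alpha$ in the unit interval is a Liouville number if for every positive integer $n$ there are integers $p>0$ and $q>1$ such that $0<\left|\alpha-\frac{p}{q}\right|<\frac{1}{q^n}$. *)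

theory Defs
  imports "HOL-Analysis.Analysis" "HOL-Library.Stream"
begin

text \<open>
  Binary strings are \<open>bool list\<close>s, with \<open>False\<close> for the digit 0 and \<open>True\<close> for the digit 1.
  For \<open>i \<le> length w\<close>, \<open>take i (rotate k w)\<close> is the string of length \<open>i\<close> read cyclically in \<open>w\<close>
  from position \<open>k\<close>; the bound on \<open>i\<close> holds when \<open>length w = 2 ^ i\<close>.
\<close>

definition de_bruijn :: "nat \<Rightarrow> bool list \<Rightarrow> bool" where
  "de_bruijn i w \<longleftrightarrow>
     length w = 2 ^ i \<and>
     (\<forall>u :: bool list. length u = i \<longrightarrow> (\<exists>!k. k < length w \<and> take i (rotate k w) = u))"

definition string_power :: "'a list \<Rightarrow> nat \<Rightarrow> 'a list" where
  "string_power w t = concat (replicate t w)"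

text \<open>
  The infinite string whose blocks are \<open>i ^ i\<close> copies of \<open>B i\<close>, for \<open>i = 1, 2, \<dots>\<close>. The constant \<open>flat\<close> is concatenation only for
  streams of nonempty lists; the blocks here are nonempty because \<open>B i\<close> has length \<open>2 ^ i\<close>.
\<close>

definition block_stream :: "(nat \<Rightarrow> bool list) \<Rightarrow> bool stream" where
  "block_stream B = flat (smap (\<lambda>i. string_power (B i) (i ^ i)) (fromN 1))"

definition has_binary_expansion :: "real \<Rightarrow> bool stream \<Rightarrow> bool" where
  "has_binary_expansion \<alpha> s \<longleftrightarrow> (\<lambda>n. of_bool (s !! n) / 2 ^ Suc n) sums \<alpha>"

definition liouville_number :: "real \<Rightarrow> bool" where
  "liouville_number \<alpha> \<longleftrightarrow>
     \<alpha> \<in> {0..1} \<and>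
     (\<forall>n::nat. n > 0 \<longrightarrow>
       (\<exists>p q :: int. p > 0 \<and> q > 1 \<and>
          0 < \<bar>\<alpha> - real_of_int p / real_of_int q\<bar> \<and>
          \<bar>\<alpha> - real_of_int p / real_of_int q\<bar> < 1 / real_of_int q ^ n))"

end

theory Submission
  imports Defs
begin

text \<open>
  Cutting the expansion before the \<open>k\<close>-th block and continuing with \<open>B k\<close> periodically gives a
  rational number with denominator \<open>q = 2 ^ L * (2 ^ 2 ^ k - 1)\<close>, where \<open>L = (\<Sum>i=1..<k. (2 * i) ^ i)\<close>
  is the length of the preceding blocks. It agrees with \<open>\<alpha>\<close> on \<open>L + (2 * k) ^ k\<close> digits,
  and for \<open>k = 2 * n\<close> this is at least \<open>n * (L + 2 ^ k)\<close>, so the error is below \<open>1 / q ^ n\<close>.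
  The error is not zero because \<open>\<alpha>\<close> is irrational: \<open>B k\<close> contains \<open>k\<close> cyclically
  consecutive zeros, so the expansion has arbitrarily long runs of zeros, each followed by a later
  digit 1, and hence some \<open>2 ^ m * \<alpha>\<close> have arbitrarily small positive fractional parts.
\<close>

section \<open>Real values of binary streams\<close>

definition binary_value :: "bool stream \<Rightarrow> real" where
  "binary_value s = (\<Sum>n. of_bool (s !! n) / 2 ^ Suc n)"

lemma summable_binary: "summable (\<lambda>n. of_bool (s !! n) / 2 ^ Suc n :: real)"
proof (rule summable_comparison_test')
  show "summable (\<lambda>n. (1 / 2) ^ Suc n :: real)"
    using power_half_series by (rule sums_summable)
  show "norm (of_bool (s !! n) / 2 ^ Suc n :: real) \<le> (1 / 2) ^ Suc n" for n
    by (simp add: power_divide)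
qed

lemma binary_value_nonneg: "0 \<le> binary_value s"
  unfolding binary_value_def by (rule suminf_nonneg[OF summable_binary]) simp

lemma binary_value_le_1: "binary_value s \<le> 1"
proof -
  have "binary_value s \<le> (\<Sum>n. (1 / 2) ^ Suc n)"
    unfolding binary_value_def
    by (rule suminf_le[OF _ summable_binary sums_summable[OF power_half_series]])
      (simp add: power_divide)
  also have "\<dots> = 1"
    using power_half_series by (rule sums_unique[symmetric])
  finally show ?thesis .
qed

lemma binary_value_pos:
  assumes "True \<in> sset s"
  shows "0 < binary_value s"
proof -
  from assms obtain n where "s !! n"
    by (auto simp: sset_range)
  then show ?thesis
    unfolding binary_value_def by (intro suminf_pos2[OF summable_binary, where i = n]) auto
qed

lemma binary_value_SCons: "binary_value (x ## s) = (of_bool x + binary_value s) / 2"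
proof -
  have "binary_value (x ## s) = (\<Sum>n. of_bool (s !! n) / 2 ^ Suc n / 2) + of_bool x / 2"
    unfolding binary_value_def using suminf_split_head[OF summable_binary, of "x ## s"]
    by (simp add: field_simps)
  also have "\<dots> = (of_bool x + binary_value s) / 2"
    unfolding binary_value_def suminf_divide[OF summable_binary] by simp
  finally show ?thesis .
qed

text \<open>The integer \<open>a\<close> is the number that \<open>xs\<close> denotes in binary. It
  is quantified before \<open>s\<close> so that expansions with the same prefix can be
  compared.\<close>

lemma binary_value_shift:
  "\<exists>a::nat. \<forall>s. binary_value (xs @- s) = (real a + binary_value s) / 2 ^ length xs"
proof (induction xs)
  case Nil
  show ?case by (auto intro: exI[of _ 0])
next
  case (Cons x xs)
  then obtain a :: nat where a: "\<And>s. binary_value (xs @- s) = (a + binary_value s) / 2 ^ length xs"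
    by blast
  show ?case
    by (rule exI[of _ "a + of_bool x * 2 ^ length xs"])
      (simp add: binary_value_SCons a field_simps)
qed

lemma binary_value_replicate_False:
  "binary_value (replicate k False @- s) = binary_value s / 2 ^ k"
  by (induction k) (simp_all add: binary_value_SCons)

text \<open>Since \<open>cycle w\<close> reproduces itself after the prefix \<open>w\<close>, its
  value \<open>x\<close> solves \<open>x = (c + x) / 2 ^ length w\<close>. Nonemptiness of
  \<open>w\<close> keeps the denominator of the solution nonzero.\<close>

lemma binary_value_cycle:
  assumes "w \<noteq> []"
  obtains c :: nat where "binary_value (cycle w) = real c / (2 ^ length w - 1)"
proof -
  obtain c :: nat where c: "\<And>s. binary_value (w @- s) = (real c + binary_value s) / 2 ^ length w"
    using binary_value_shift by blast
  have "(2::real) ^ length w > 1"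
    using assms by simp
  moreover have "binary_value (cycle w) = (real c + binary_value (cycle w)) / 2 ^ length w"
    using c[of "cycle w"] cycle_decomp[OF assms] by simp
  ultimately have "binary_value (cycle w) = real c / (2 ^ length w - 1)"
    by (simp add: field_simps)
  then show ?thesis by (rule that)
qed

text \<open>The integer contributed by \<open>xs\<close> cancels, and the values of the two tails
  lie in the unit interval.\<close>

lemma binary_value_shift_diff:
  "\<bar>binary_value (xs @- s) - binary_value (xs @- t)\<bar> \<le> 1 / 2 ^ length xs"
proof -
  obtain a :: nat where a: "\<And>s. binary_value (xs @- s) = (real a + binary_value s) / 2 ^ length xs"
    using binary_value_shift by blast
  have "binary_value (xs @- s) - binary_value (xs @- t)
      = (binary_value s - binary_value t) / 2 ^ length xs"
    by (simp add: a diff_divide_distrib add_divide_distrib)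
  moreover have "\<bar>binary_value s - binary_value t\<bar> \<le> 1"
    using binary_value_nonneg[of s] binary_value_nonneg[of t]
      binary_value_le_1[of s] binary_value_le_1[of t] by linarith
  ultimately show ?thesis
    by (simp add: divide_right_mono)
qed

section \<open>Repeated words and factors of de Bruijn words\<close>

lemma length_string_power [simp]: "length (string_power w t) = t * length w"
  by (simp add: string_power_def length_concat sum_list_replicate)

lemma string_power_shift_cycle:
  assumes "w \<noteq> []"
  shows "string_power w t @- cycle w = cycle w"
proof (induction t)
  case 0
  show ?case by (simp add: string_power_def)
next
  case (Suc t)
  then show ?case
    using cycle_decomp[OF assms] by (simp add: string_power_def)
qed

lemma string_power_add: "string_power w (s + t) = string_power w s @ string_power w t"
  by (simp add: string_power_def replicate_add)

text \<open>Turns cyclic occurrences in \<open>w\<close> into ordinary factors of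
  \<open>w @ w\<close>.\<close>

lemma append_self_conv_rotate:
  assumes "j < length w"
  shows "w @ w = take j w @ rotate j w @ drop j w"
  using assms by (simp add: rotate_drop_take)

text \<open>The cyclic occurrence of the zero word may wrap around the end of \<open>w\<close>, so
  two adjacent copies are used to make it contiguous.\<close>

lemma de_bruijn_zero_run:
  assumes "de_bruijn k w" "2 \<le> t"
  obtains u v where "string_power w t = u @ replicate k False @ v"
proof -
  from assms(1) obtain j where j: "j < length w" "take k (rotate j w) = replicate k False"
    unfolding de_bruijn_def by (metis length_replicate)
  have "string_power w t = string_power w (2 + (t - 2))"
    using assms(2) by (simp only: le_add_diff_inverse)
  also have "\<dots> = (w @ w) @ string_power w (t - 2)"
    unfolding string_power_add by (simp add: string_power_def numeral_2_eq_2)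
  also have "w @ w = take j w @ replicate k False @ drop k (rotate j w) @ drop j w"
    using append_self_conv_rotate[OF j(1)] j(2) append_take_drop_id[of k "rotate j w"]
    by (metis append.assoc)
  finally show ?thesis
    using that by simp
qed

lemma de_bruijn_True_in_set:
  assumes "de_bruijn k w" "k \<ge> 1"
  shows "True \<in> set w"
proof -
  from assms(1) obtain j where j: "take k (rotate j w) = replicate k True"
    unfolding de_bruijn_def by (metis length_replicate)
  have "True \<in> set (take k (rotate j w))"
    using assms(2) unfolding j by simp
  then show ?thesis
    using set_take_subset by fastforce
qed

section \<open>Block structure of the expansion\<close>

text \<open>The starting index of \<open>block_stream\<close> becomes a parameter, so that blocks
  can be split off one at a time by induction.\<close>

definition block_tail :: "(nat \<Rightarrow> bool list) \<Rightarrow> nat \<Rightarrow> bool stream" where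
  "block_tail B k = flat (smap (\<lambda>i. string_power (B i) (i ^ i)) (fromN k))"

context
  fixes B :: "nat \<Rightarrow> bool list"
  assumes de_bruijn_B: "\<And>i. i \<ge> 1 \<Longrightarrow> de_bruijn i (B i)"
begin

lemma length_B: "k \<ge> 1 \<Longrightarrow> length (B k) = 2 ^ k"
  using de_bruijn_B by (simp add: de_bruijn_def)

lemma B_nonempty: "k \<ge> 1 \<Longrightarrow> B k \<noteq> []"
  using length_B by fastforce

lemma block_tail_unfold:
  assumes "k \<ge> 1"
  shows "block_tail B k = string_power (B k) (k ^ k) @- block_tail B (Suc k)"
proof -
  have "string_power (B k) (k ^ k) \<noteq> []"
    using assms length_B[OF assms] length_string_power[of "B k" "k ^ k"] by fastforce
  then show ?thesis
    unfolding block_tail_def by (subst flat_unfold) simp_all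
qed

lemma block_stream_split:
  assumes "k \<ge> 1"
  obtains P where "block_stream B = P @- block_tail B k"
    and "length P = (\<Sum>i=1..<k. (2 * i) ^ i)"
proof -
  from assms have "\<exists>P. block_stream B = P @- block_tail B k \<and> length P = (\<Sum>i=1..<k. (2 * i) ^ i)"
  proof (induction k rule: dec_induct)
    case base
    show ?case by (auto simp: block_stream_def block_tail_def)
  next
    case (step k)
    then obtain P where P: "block_stream B = P @- block_tail B k"
      "length P = (\<Sum>i=1..<k. (2 * i) ^ i)"
      by blast
    have "block_stream B = (P @ string_power (B k) (k ^ k)) @- block_tail B (Suc k)"
      using P(1) block_tail_unfold[OF step(1)] by simp
    moreover have "length (P @ string_power (B k) (k ^ k)) = (\<Sum>i=1..<Suc k. (2 * i) ^ i)"
      using P(2) step length_B by (simp add: power_mult_distrib mult.commute)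
    ultimately show ?case by blast
  qed
  then show ?thesis using that by blast
qed

lemma True_in_block_tail:
  assumes "k \<ge> 1"
  shows "True \<in> sset (block_tail B k)"
proof -
  have "True \<in> set (string_power (B k) (k ^ k))"
    using de_bruijn_True_in_set[OF de_bruijn_B] assms
    by (simp add: string_power_def set_replicate_conv_if)
  then show ?thesis
    using block_tail_unfold[OF assms] by simp
qed

lemma binary_value_block_stream_irrational:
  fixes p q :: int
  assumes "q > 0"
  shows "binary_value (block_stream B) \<noteq> of_int p / of_int q"
proof
  assume rat: "binary_value (block_stream B) = of_int p / of_int q"
  \<comment> \<open>This choice gives \<open>q < 2 ^ k\<close>, and \<open>k \<ge> 2\<close> makes
    the \<open>k\<close>-th block contain at least two copies of \<open>B k\<close>.\<close>
  define k where "k = nat q + 1"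
  have k: "2 \<le> k" "1 \<le> k"
    using assms by (simp_all add: k_def)
  have "q < int k"
    using assms by (simp add: k_def)
  also have "int k < 2 ^ k"
    by (rule of_nat_less_two_power)
  finally have "real_of_int q < 2 ^ k"
    by (metis of_int_less_numeral_power_cancel_iff)
  have "k ^ 1 \<le> k ^ k"
    using k by (intro power_increasing) auto
  with k(1) have "2 \<le> k ^ k"
    by (simp only: power_one_right)
  then obtain u v where uv: "string_power (B k) (k ^ k) = u @ replicate k False @ v"
    using de_bruijn_zero_run[OF de_bruijn_B[OF k(2)]] by blast
  obtain P where P: "block_stream B = P @- block_tail B k"
    using block_stream_split[OF k(2)] by blast
  define s where "s = v @- block_tail B (Suc k)"
  have split: "block_stream B = (P @ u) @- replicate k False @- s"
    using P uv block_tail_unfold[OF k(2)] by (simp add: s_def)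
  obtain a :: nat where
    a: "\<And>s. binary_value ((P @ u) @- s) = (real a + binary_value s) / 2 ^ length (P @ u)"
    using binary_value_shift by blast
  \<comment> \<open>The digit 1 is taken from the blocks after the \<open>k\<close>-th, as nothing
    is known about \<open>v\<close>.\<close>
  have pos: "0 < binary_value s"
    using True_in_block_tail[of "Suc k"] by (intro binary_value_pos) (simp add: s_def)
  \<comment> \<open>Multiplying the value of the expansion by \<open>q * 2 ^ length (P @ u)\<close>
    yields \<open>q * a + r\<close>. If the value is \<open>p / q\<close>, then \<open>r\<close> is
    an integer, yet it lies strictly between 0 and 1.\<close>
  define r where "r = of_int q * binary_value s / 2 ^ k"
  have "of_int p / of_int q = (real a + binary_value s / 2 ^ k) / 2 ^ length (P @ u)"
    using rat unfolding split a binary_value_replicate_False by simp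
  then have "r = of_int (p * 2 ^ length (P @ u) - q * int a)"
    using assms by (simp add: r_def field_simps)
  moreover have "0 < r"
    using pos assms by (simp add: r_def)
  moreover have "r < 1"
  proof -
    have "of_int q * binary_value s \<le> of_int q * 1"
      using assms binary_value_le_1 by (intro mult_left_mono) auto
    also have "\<dots> < 2 ^ k"
      using \<open>real_of_int q < 2 ^ k\<close> by simp
    finally show ?thesis by (simp add: r_def)
  qed
  ultimately show False
    by (metis of_int_0_less_iff of_int_less_1_iff zless_imp_add1_zle add_0 not_le)
qed

lemma binary_value_block_stream_approx:
  assumes "k \<ge> 1"
  defines "L \<equiv> \<Sum>i=1..<k. (2 * i) ^ i"
  obtains p :: int where "p > 0"
    and "\<bar>binary_value (block_stream B) - of_int p / of_int (2 ^ L * (2 ^ 2 ^ k - 1))\<bar>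
      \<le> 1 / 2 ^ (L + (2 * k) ^ k)"
proof -
  have B: "B k \<noteq> []" "length (B k) = 2 ^ k"
    using B_nonempty length_B assms by auto
  obtain P where P: "block_stream B = P @- block_tail B k" "length P = L"
    unfolding L_def using block_stream_split assms(1) by blast
  define W where "W = string_power (B k) (k ^ k)"
  obtain c :: nat where c: "binary_value (cycle (B k)) = real c / (2 ^ length (B k) - 1)"
    using binary_value_cycle[OF B(1)] .
  obtain a :: nat where
    a: "\<And>s. binary_value (P @- s) = (real a + binary_value s) / 2 ^ length P"
    using binary_value_shift by blast
  have M: "(2::real) ^ 2 ^ k > 1" "(2::int) ^ 2 ^ k > 1"
    by simp_all
  \<comment> \<open>The numerator of \<open>a + c / (2 ^ 2 ^ k - 1)\<close>, where \<open>a\<close>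
    comes from the prefix and \<open>c\<close> from the period. As \<open>a\<close> may be 0,
    positivity of \<open>p\<close> rests on \<open>c\<close>, hence on a digit 1 in
    \<open>B k\<close>.\<close>
  define p :: int where "p = int a * (2 ^ 2 ^ k - 1) + int c"
  have "0 < binary_value (cycle (B k))"
    using de_bruijn_True_in_set[OF de_bruijn_B] assms(1) cycle_decomp[OF B(1)]
    by (intro binary_value_pos) (metis UnI1 sset_shift)
  then have "c > 0"
    unfolding c by (cases "c = 0") auto
  then have "p > 0"
    using M(2) by (simp add: p_def add_nonneg_pos)
  moreover have "binary_value (P @- cycle (B k)) = of_int p / of_int (2 ^ L * (2 ^ 2 ^ k - 1))"
  proof -
    define D :: real where "D = 2 ^ 2 ^ k - 1"
    then have "D > 0"
      using M(1) by simp
    then have "(real a + real c / D) / 2 ^ L = (real a * D + real c) / (2 ^ L * D)"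
      by (simp add: field_simps)
    then show ?thesis
      unfolding a c B(2) P(2) p_def by (simp add: D_def)
  qed
  moreover have "\<bar>binary_value ((P @ W) @- block_tail B (Suc k)) - binary_value ((P @ W) @- cycle (B k))\<bar>
      \<le> 1 / 2 ^ length (P @ W)"
    by (rule binary_value_shift_diff)
  moreover have "(P @ W) @- block_tail B (Suc k) = block_stream B"
    using P(1) block_tail_unfold[OF assms(1)] by (simp add: W_def)
  \<comment> \<open>The periodic stream absorbs the whole copies of \<open>B k\<close> in
    \<open>W\<close>, so it shares the full prefix \<open>P @ W\<close> with the expansion.\<close>
  moreover have "(P @ W) @- cycle (B k) = P @- cycle (B k)"
    using string_power_shift_cycle[OF B(1)] by (simp add: W_def)
  moreover have "length (P @ W) = L + (2 * k) ^ k"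
    using P(2) B(2) by (simp add: W_def power_mult_distrib mult.commute)
  ultimately show ?thesis
    using that by simp
qed

end

section \<open>Growth of the block lengths\<close>

text \<open>Raising every base to \<open>2 * k\<close> gives a geometric series, whose product with
  \<open>2 * k - 1\<close> is \<open>(2 * k) ^ k - 1\<close>; and
  \<open>k \<le> 2 * k - 1\<close>.\<close>

lemma sum_double_powers_bound:
  fixes k :: nat
  assumes "k \<ge> 1"
  shows "k * (\<Sum>i=1..<k. (2 * i) ^ i) \<le> (2 * k) ^ k"
proof -
  have "(\<Sum>i=1..<k. (2 * i) ^ i) \<le> (\<Sum>i=1..<k. (2 * k) ^ i)"
    by (intro sum_mono power_mono) auto
  also have "\<dots> \<le> (\<Sum>i<k. (2 * k) ^ i)"
    by (intro sum_mono2) auto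
  finally have "k * (\<Sum>i=1..<k. (2 * i) ^ i) \<le> (2 * k - 1) * (\<Sum>i<k. (2 * k) ^ i)"
    using assms by (intro mult_mono) auto
  also have "\<dots> \<le> (2 * k) ^ k"
  proof -
    have "int ((2 * k - 1) * (\<Sum>i<k. (2 * k) ^ i)) = int ((2 * k) ^ k) - 1"
      using assms power_diff_1_eq[of "2 * int k" k] by (simp add: of_nat_diff)
    then show ?thesis by linarith
  qed
  finally show ?thesis .
qed

text \<open>After multiplication by \<open>k\<close>, each of the two summands is at most
  \<open>(2 * k) ^ k\<close>; writing \<open>k\<close> as \<open>2 * n\<close> absorbs the resulting
  factor 2.\<close>

lemma approx_exponent_bound:
  fixes n :: nat
  assumes "n \<ge> 1" and "k = 2 * n"
  shows "n * ((\<Sum>i=1..<k. (2 * i) ^ i) + 2 ^ k) \<le> (2 * k) ^ k"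
proof -
  have "k ^ 1 \<le> k ^ k"
    using assms by (intro power_increasing) auto
  then have "k * 2 ^ k \<le> (2 * k) ^ k"
    by (simp add: power_mult_distrib mult.commute)
  moreover have "k * (\<Sum>i=1..<k. (2 * i) ^ i) \<le> (2 * k) ^ k"
    using assms by (intro sum_double_powers_bound) auto
  ultimately have "k * ((\<Sum>i=1..<k. (2 * i) ^ i) + 2 ^ k) \<le> 2 * (2 * k) ^ k"
    by (simp only: distrib_left)
  then show ?thesis
    unfolding assms(2) by (simp only: mult.assoc)
qed

theorem lemma1:
  fixes B :: "nat \<Rightarrow> bool list" and \<alpha> :: real
  assumes "\<And>i. i \<ge> 1 \<Longrightarrow> de_bruijn i (B i)"
    and "\<alpha> \<in> {0..<1}"
    and "has_binary_expansion \<alpha> (block_stream B)"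
  shows "liouville_number \<alpha>"
proof -
  have \<alpha>: "\<alpha> = binary_value (block_stream B)"
    using assms(3) unfolding has_binary_expansion_def binary_value_def by (rule sums_unique)
  have "\<exists>p q :: int. p > 0 \<and> q > 1 \<and> 0 < \<bar>\<alpha> - of_int p / of_int q\<bar> \<and>
      \<bar>\<alpha> - of_int p / of_int q\<bar> < 1 / of_int q ^ n" if "n > 0" for n
  proof -
    define k where "k = 2 * n"
    define L where "L = (\<Sum>i=1..<k. (2 * i) ^ i)"
    define q :: int where "q = 2 ^ L * (2 ^ 2 ^ k - 1)"
    have k: "k \<ge> 1"
      using that by (simp add: k_def)
    obtain p :: int where p: "p > 0" "\<bar>\<alpha> - of_int p / of_int q\<bar> \<le> 1 / 2 ^ (L + (2 * k) ^ k)"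
      using binary_value_block_stream_approx[OF assms(1) k] unfolding \<alpha> q_def L_def by blast
    \<comment> \<open>Leads to \<open>2 ^ 2 ^ k - 1 > 1\<close>, so \<open>q > 1\<close> without a
      lower bound on \<open>L\<close>.\<close>
    have "(2::nat) ^ 0 < 2 ^ k"
      using k by (intro power_strict_increasing) auto
    then have "(2::int) ^ 1 < 2 ^ 2 ^ k"
      by (intro power_strict_increasing) auto
    then have "1 * 1 < q"
      unfolding q_def by (intro mult_le_less_imp_less) auto
    \<comment> \<open>The subtracted 1 in \<open>q\<close> makes this strict, which supplies the
      strict error bound; the approximation itself is only bounded by \<open>\<le>\<close>.\<close>
    have "q < 2 ^ (L + 2 ^ k)"
      by (simp add: q_def power_add)
    then have "q ^ n < (2 ^ (L + 2 ^ k)) ^ n"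
      using that \<open>1 * 1 < q\<close> by (intro power_strict_mono) auto
    also have "\<dots> = 2 ^ (n * (L + 2 ^ k))"
      by (simp add: power_mult[symmetric] mult.commute)
    also have "\<dots> \<le> 2 ^ (L + (2 * k) ^ k)"
      using approx_exponent_bound[of n k] that
      by (intro power_increasing) (auto simp: k_def L_def)
    finally have "real_of_int (q ^ n) < real_of_int (2 ^ (L + (2 * k) ^ k))"
      by (simp only: of_int_less_iff)
    then have "1 / 2 ^ (L + (2 * k) ^ k) < 1 / real_of_int q ^ n"
      using \<open>1 * 1 < q\<close> by (intro divide_strict_left_mono) auto
    moreover have "\<alpha> \<noteq> of_int p / of_int q"
      using binary_value_block_stream_irrational[OF assms(1)] \<open>1 * 1 < q\<close> unfolding \<alpha> by simp
    ultimately show ?thesis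
      using p \<open>1 * 1 < q\<close> by (intro exI[of _ p] exI[of _ q]) auto
  qed
  then show ?thesis
    using assms(2) by (auto simp: liouville_number_def)
qed

end
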